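(* Let $r>0$ and $-1<\lambda<1$ be constants, let $\alpha(t)=re^{\lambda t}$, and identify $dS_4(f_\alpha)$ isometrically with $\mathbb{R}\times S^3$ carrying the metric $g=((\alpha')^2-\alpha^2)\,dt\otimes dt+\alpha^2\cosh^2 t\,\Omega_3$. Define $$f_\lambda(t):=\frac{(\lambda\cosh t+\sinh t)(3\sinh t+2\lambda\cosh t)+3-2\lambda^2}{1-\lambda^2}.$$ Then, in the local coordinates $(t,\psi,\theta,\phi)$, the non-zero components of the Ricci tensor of $g$ are $$R_{tt}=-3(1+\lambda\tanh t),\quad R_{\psi\psi}=f_\lambda(t),\quad R_{\theta\theta}=f_\lambda(t)\sin^2\psi,\quad R_{\phi\phi}=f_\lambda(t)\sin^2\psi\sin^2\theta$$ (all other components vanish), and the scalar curvature is $$S=\frac{3}{\alpha^2}\left(\frac{1+\lambda\tanh t}{1-\lambda^2}+\frac{f_\lambda(t)}{\cosh^2 t}\right).$$ In particular, if $0<\lambda<1$ then $\lim_{t\to\infty}S=0$ and $\lim_{t\to-\infty}S=\infty$, and if $-1<\lambda<0$ then $\lim_{t\to\infty}S=\infty$ and $\lim_{t\to-\infty}S=0$.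
   Context: $\mathbb{R}^{5}_1$ is $\mathbb{R}^{5}$ with metric $\eta=-dx^0\otimes dx^0+dx^1\otimes dx^1+\cdots+dx^4\otimes dx^4$. For a smooth function $f:(a,b)\to\mathbb{R}$ on an open interval (possibly unbounded), $dS_4(f)$ is the hypersurface $\{x\in\mathbb{R}^5_1 : x^0\in(a,b),\ -(x^0)^2+(x^1)^2+\cdots+(x^4)^2=f(x^0)^2\}$ with the metric induced from $\eta$. Here $f_\alpha:=\alpha\circ h^{-1}$ on $h(\mathbb{R})$ with $h(t):=\alpha(t)\sinh t$ (which has nonvanishing derivative for the given $\alpha$); this is a function distinct from $f_\lambda$. An isometry of $\mathbb{R}\times S^3$ with the stated metric onto $dS_4(f_\alpha)$ is $(t,z)\mapsto(\alpha(t)\sinh t,\ z\,\alpha(t)\cosh t)$, $z\in S^3\subset\mathbb{R}^4$. $\Omega_3$ is the round metric on the unit sphere $S^3$ (pulled back to $\mathbb{R}\times S^3$). $(\psi,\theta,\phi)$ are hyperspherical coordinates on $S^3\subset\mathbb{R}^4$: the four Cartesian coordinates are $\cos\psi$, $\sin\psi\cos\theta$, $\sin\psi\sin\theta\cos\phi$, $\sin\psi\sin\theta\sin\phi$ (with $0<\psi,\theta<\pi$), so that $g_{tt}=\alpha^2(\lambda^2-1)$, $g_{\psi\psi}=\alpha^2\cosh^2t$, $g_{\theta\theta}=\alpha^2\cosh^2t\sin^2\psi$, $g_{\phi\phi}=\alpha^2\cosh^2t\sin^2\psi\sin^2\theta$. Conventions (Einstein summation): $\Gamma^\rho_{\mu\nu}=\frac12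 g^{\rho\sigma}(\partial_\mu g_{\nu\sigma}+\partial_\nu g_{\mu\sigma}-\partial_\sigma g_{\mu\nu})$, $R_{\mu\nu}=\partial_\rho\Gamma^\rho_{\nu\mu}-\partial_\nu\Gamma^\rho_{\rho\mu}+\Gamma^\rho_{\rho\kappa}\Gamma^\kappa_{\nu\mu}-\Gamma^\rho_{\nu\kappa}\Gamma^\kappa_{\rho\mu}$, and $S=g^{\mu\nu}R_{\mu\nu}$. *)

theory Defs
  imports "HOL-Analysis.Analysis"
begin

section \<open>Curvature of a metric given by its components in local coordinates\<close>

definition pdiff :: "'n::finite \<Rightarrow> (real^'n \<Rightarrow> 'b::real_normed_vector) \<Rightarrow> real^'n \<Rightarrow> 'b" where
  "pdiff \<mu> F x = vector_derivative (\<lambda>s. F (x + s *\<^sub>R axis \<mu> 1)) (at 0)"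

definition christoffel ::
    "(real^'n::finite \<Rightarrow> real^'n^'n) \<Rightarrow> 'n \<Rightarrow> 'n \<Rightarrow> 'n \<Rightarrow> real^'n \<Rightarrow> real" where
  "christoffel G \<rho> \<mu> \<nu> x =
     1/2 * (\<Sum>\<sigma>\<in>UNIV. matrix_inv (G x) $ \<rho> $ \<sigma> *
              (pdiff \<mu> (\<lambda>y. G y $ \<nu> $ \<sigma>) x + pdiff \<nu> (\<lambda>y. G y $ \<mu> $ \<sigma>) x
                - pdiff \<sigma> (\<lambda>y. G y $ \<mu> $ \<nu>) x))"

definition ricci ::
    "(real^'n::finite \<Rightarrow> real^'n^'n) \<Rightarrow> 'n \<Rightarrow> 'n \<Rightarrow> real^'n \<Rightarrow> real" where
  "ricci G \<mu> \<nu> x =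
     (\<Sum>\<rho>\<in>UNIV. pdiff \<rho> (christoffel G \<rho> \<nu> \<mu>) x)
     - (\<Sum>\<rho>\<in>UNIV. pdiff \<nu> (christoffel G \<rho> \<rho> \<mu>) x)
     + (\<Sum>\<rho>\<in>UNIV. \<Sum>\<kappa>\<in>UNIV. christoffel G \<rho> \<rho> \<kappa> x * christoffel G \<kappa> \<nu> \<mu> x)
     - (\<Sum>\<rho>\<in>UNIV. \<Sum>\<kappa>\<in>UNIV. christoffel G \<rho> \<nu> \<kappa> x * christoffel G \<kappa> \<rho> \<mu> x)"

definition scalar_curvature :: "(real^'n::finite \<Rightarrow> real^'n^'n) \<Rightarrow> real^'n \<Rightarrow> real" where
  "scalar_curvature G x =
     (\<Sum>\<mu>\<in>UNIV. \<Sum>\<nu>\<in>UNIV. matrix_inv (G x) $ \<mu> $ \<nu> * ricci G \<mu> \<nu> x)"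

section \<open>The hypersurface and its model\<close>

text \<open>Minkowski space is \<open>real \<times> (real^4)\<close>: the first component is the time coordinate
  with index 0, the second one collects the four spatial coordinates.\<close>

definition eta :: "real \<times> (real^4) \<Rightarrow> real \<times> (real^4) \<Rightarrow> real" where
  "eta u v = - (fst u * fst v) + snd u \<bullet> snd v"

definition dS4 :: "real set \<Rightarrow> (real \<Rightarrow> real) \<Rightarrow> (real \<times> (real^4)) set" where
  "dS4 I f = {x. fst x \<in> I \<and> - (fst x)\<^sup>2 + (\<Sum>i\<in>UNIV. (snd x $ i)\<^sup>2) = (f (fst x))\<^sup>2}"

definition h_fun :: "(real \<Rightarrow> real) \<Rightarrow> real \<Rightarrow> real" where
  "h_fun \<alpha> t = \<alpha> t * sinh t"

text \<open>To be used only for injective \<open>h_fun \<alpha>\<close>, and only on \<open>range (h_fun \<alpha>)\<close>.\<close>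

definition f_alpha :: "(real \<Rightarrow> real) \<Rightarrow> real \<Rightarrow> real" where
  "f_alpha \<alpha> = \<alpha> \<circ> inv (h_fun \<alpha>)"

definition RS3 :: "(real \<times> (real^4)) set" where
  "RS3 = UNIV \<times> sphere 0 1"

definition tangent_RS3 :: "real \<times> (real^4) \<Rightarrow> (real \<times> (real^4)) set" where
  "tangent_RS3 p = {v. snd p \<bullet> snd v = 0}"

definition Phi :: "(real \<Rightarrow> real) \<Rightarrow> real \<times> (real^4) \<Rightarrow> real \<times> (real^4)" where
  "Phi \<alpha> = (\<lambda>(t, z). (\<alpha> t * sinh t, (\<alpha> t * cosh t) *\<^sub>R z))"

text \<open>The tensor field \<open>((\<alpha>')\<^sup>2 - \<alpha>\<^sup>2) dt \<otimes> dt + \<alpha>\<^sup>2 cosh\<^sup>2 t \<Omega>\<^sub>3\<close>, to be evaluated at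
  \<open>p \<in> RS3\<close> on vectors of \<open>tangent_RS3 p\<close>; there the round metric \<open>\<Omega>\<^sub>3\<close> is the Euclidean
  inner product of the sphere components.\<close>

definition g_metric ::
    "(real \<Rightarrow> real) \<Rightarrow> real \<times> (real^4) \<Rightarrow> real \<times> (real^4) \<Rightarrow> real \<times> (real^4) \<Rightarrow> real" where
  "g_metric \<alpha> p u v =
     ((deriv \<alpha> (fst p))\<^sup>2 - (\<alpha> (fst p))\<^sup>2) * (fst u * fst v)
     + (\<alpha> (fst p))\<^sup>2 * (cosh (fst p))\<^sup>2 * (snd u \<bullet> snd v)"

primrec C_k :: "nat \<Rightarrow> ('a::real_normed_vector \<Rightarrow> 'b::real_normed_vector) \<Rightarrow> bool" where
  "C_k 0 F \<longleftrightarrow> continuous_on UNIV F"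
| "C_k (Suc k) F \<longleftrightarrow>
     (\<forall>p. F differentiable (at p)) \<and> (\<forall>v. C_k k (\<lambda>p. frechet_derivative F (at p) v))"

text \<open>A homeomorphism from \<open>RS3\<close> onto \<open>N\<close>, given by a smooth map of the ambient spaces, whose
  differential pulls \<open>eta\<close> back to \<open>g\<close>. Since the \<open>g\<close> used here is nondegenerate, \<open>F\<close> is then
  an immersion of \<open>RS3\<close> and a homeomorphism onto its image, hence a diffeomorphism onto the
  embedded submanifold \<open>N\<close>, and an isometry for the metric induced on \<open>N\<close> by \<open>eta\<close>.\<close>

definition isometry_RS3_onto ::
    "(real \<times> (real^4) \<Rightarrow> real \<times> (real^4) \<Rightarrow> real \<times> (real^4) \<Rightarrow> real) \<Rightarrow> (real \<times> (real^4)) set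
      \<Rightarrow> (real \<times> (real^4) \<Rightarrow> real \<times> (real^4)) \<Rightarrow> bool" where
  "isometry_RS3_onto g N F \<longleftrightarrow>
     (\<forall>k. C_k k F) \<and>
     (\<exists>F'. homeomorphism RS3 N F F') \<and>
     (\<forall>p\<in>RS3. \<forall>u\<in>tangent_RS3 p. \<forall>v\<in>tangent_RS3 p.
        eta (frechet_derivative F (at p) u) (frechet_derivative F (at p) v) = g p u v)"

section \<open>Hyperspherical coordinates\<close>

text \<open>The coordinates \<open>(t, \<psi>, \<theta>, \<phi>)\<close> carry the indices 1, 2, 3, 4 of \<open>real^4\<close>.
  The chart is regular where \<open>0 < \<psi> < \<pi>\<close> and \<open>0 < \<theta> < \<pi>\<close>, with \<open>\<phi>\<close> any real
  (an angle).\<close>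

definition chart :: "real^4 \<Rightarrow> real \<times> (real^4)" where
  "chart x = (x $ 1,
     vector [cos (x $ 2),
             sin (x $ 2) * cos (x $ 3),
             sin (x $ 2) * sin (x $ 3) * cos (x $ 4),
             sin (x $ 2) * sin (x $ 3) * sin (x $ 4)])"

text \<open>Confirms that \<open>vector\<close> fills the indices 1, 2, 3, 4 in this order (in type 4, \<open>4 = 0\<close>).\<close>

lemma vector_4:
  "(vector [a, b, c, d] :: ('a::zero)^4) $ 1 = a"
  "(vector [a, b, c, d] :: ('a::zero)^4) $ 2 = b"
  "(vector [a, b, c, d] :: ('a::zero)^4) $ 3 = c"
  "(vector [a, b, c, d] :: ('a::zero)^4) $ 4 = d"
  unfolding vector_def by simp_all

definition g_coord :: "(real \<Rightarrow> real) \<Rightarrow> real^4 \<Rightarrow> real^4^4" where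
  "g_coord \<alpha> x = (\<chi> \<mu> \<nu>. g_metric \<alpha> (chart x) (pdiff \<mu> chart x) (pdiff \<nu> chart x))"

definition f_lam :: "real \<Rightarrow> real \<Rightarrow> real" where
  "f_lam lam t =
     ((lam * cosh t + sinh t) * (3 * sinh t + 2 * lam * cosh t) + 3 - 2 * lam\<^sup>2) / (1 - lam\<^sup>2)"

end

theory Submission
  imports Defs
begin

text \<open>
  Differentiating \<open>Phi\<close> along a tangent vector \<open>(u, w)\<close> of \<open>\<real> \<times> S\<^sup>3\<close> gives the time component
  \<open>u (\<alpha>' sinh t + \<alpha> cosh t)\<close>, the radial component \<open>u (\<alpha>' cosh t + \<alpha> sinh t)\<close> along \<open>z\<close> and the
  component \<open>\<alpha> cosh t w\<close> orthogonal to \<open>z\<close>; as \<open>cosh\<^sup>2 - sinh\<^sup>2 = 1\<close>, the Minkowski square of the first two is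
  \<open>u\<^sup>2 (\<alpha>'\<^sup>2 - \<alpha>\<^sup>2)\<close> (\<open>pullback_eta_Phi\<close>). For \<open>\<bar>\<lambda>\<bar> < 1\<close> the function \<open>h t = \<alpha> t sinh t\<close> has positive
  derivative \<open>\<alpha> (\<lambda> sinh t + cosh t)\<close>, so the time coordinate of a point of the hypersurface determines
  \<open>t\<close>, and then \<open>z\<close> is found by rescaling (\<open>homeomorphism_Phi\<close>).

  In hyperspherical coordinates the metric is the warped product
  \<open>A(t) dt\<^sup>2 + B(t) (d\<psi>\<^sup>2 + sin\<^sup>2\<psi> d\<theta>\<^sup>2 + sin\<^sup>2\<psi> sin\<^sup>2\<theta> d\<phi>\<^sup>2)\<close> (\<open>g_coord_warped\<close>). It is diagonal, and each of
  its components and Christoffel symbols is a product of a function of \<open>t\<close>, one of \<open>\<psi>\<close> and one of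
  \<open>\<theta>\<close>, so its Ricci tensor is found by a finite computation. With
  \<open>p = A'/(2A)\<close>, \<open>H = B'/(2B)\<close> and \<open>P = - B'/(2A)\<close> it is diagonal with entries \<open>3 (p H - H\<^sup>2 - H')\<close> in the
  time direction and \<open>P' + (p + H) P + 2\<close> times the round metric (\<open>ricci_warped_sphere\<close>). For
  \<open>\<alpha> = r e\<^bsup>\<lambda>t\<^esup>\<close> one has \<open>p = \<lambda>\<close>, \<open>H = \<lambda> + tanh t\<close> and \<open>P = H cosh\<^sup>2t / (1 - \<lambda>\<^sup>2)\<close>, which yields the stated
  curvatures.

  The limits become visible once everything is written in terms of \<open>tanh t\<close>: the scalar curvature is
  \<open>6 (1 + \<lambda> tanh t) (2 + \<lambda> tanh t) e\<^bsup>-2\<lambda>t\<^esup> / (r\<^sup>2 (1 - \<lambda>\<^sup>2))\<close> (\<open>scalar_curvature_factored\<close>), where the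
  factors other than the exponential have positive limits at both ends.
\<close>

section \<open>Partial derivatives and diagonal metrics\<close>

lemma pdiff_eqI:
  assumes "((\<lambda>s. F (x + s *\<^sub>R axis \<mu> 1)) has_vector_derivative D) (at 0)"
  shows "pdiff \<mu> F x = D"
  using assms unfolding pdiff_def by (rule vector_derivative_at)

lemma pdiff_zero [simp]: "pdiff i (\<lambda>y. 0::real) x = 0"
  by (rule pdiff_eqI) simp

text \<open>Formulas for the Christoffel symbols hold only off the coordinate singularities; locality
  allows differentiating them there all the same.\<close>

lemma pdiff_cong:
  assumes "open U" "x \<in> U" "\<And>y. y \<in> U \<Longrightarrow> F y = G y"
  shows "pdiff \<mu> F x = pdiff \<mu> G x"
proof -
  have "((\<lambda>s::real. x + s *\<^sub>R axis \<mu> 1) \<longlongrightarrow> x + 0 *\<^sub>R axis \<mu> 1) (nhds 0)"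
    by (intro tendsto_intros filterlim_ident)
  then have "eventually (\<lambda>s::real. x + s *\<^sub>R axis \<mu> 1 \<in> U) (nhds 0)"
    using assms(1,2) by (simp add: topological_tendstoD)
  then have "eventually (\<lambda>s::real. F (x + s *\<^sub>R axis \<mu> 1) = G (x + s *\<^sub>R axis \<mu> 1)) (nhds 0)"
    by (rule eventually_mono) (use assms(3) in auto)
  then show ?thesis unfolding pdiff_def
    by (intro vector_derivative_cong_eq) (auto simp: assms eventually_at_filter elim: eventually_mono)
qed

lemma line_nth: "(x + s *\<^sub>R axis \<mu> 1) $ i = x $ i + (if i = \<mu> then s else 0)"
  for x :: "real^'n::finite"
  by (simp add: axis_def)

text \<open>The fourth coordinate \<open>\<phi>\<close> is cyclic, so three factors suffice for every component that
  occurs below.\<close>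

definition separable :: "(real \<Rightarrow> real) \<Rightarrow> (real \<Rightarrow> real) \<Rightarrow> (real \<Rightarrow> real) \<Rightarrow> real^4 \<Rightarrow> real" where
  "separable f g k = (\<lambda>y. f (y $ 1) * g (y $ 2) * k (y $ 3))"

lemma pdiff_separable:
  assumes "f field_differentiable at (x $ 1)"
    and "g field_differentiable at (x $ 2)"
    and "k field_differentiable at (x $ 3)"
  shows "pdiff \<mu> (separable f g k) x =
     (if \<mu> = 1 then deriv f (x $ 1) * g (x $ 2) * k (x $ 3)
      else if \<mu> = 2 then f (x $ 1) * deriv g (x $ 2) * k (x $ 3)
      else if \<mu> = 3 then f (x $ 1) * g (x $ 2) * deriv k (x $ 3) else 0)"
proof (rule pdiff_eqI)
  have D: "((\<lambda>s. F (c + s)) has_real_derivative deriv F c) (at 0)"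
    if "F field_differentiable at c" for F and c :: real
    using field_differentiable_derivI[OF that] DERIV_shift[of F "deriv F c" 0 c]
    by (simp add: add.commute)
  note [derivative_intros] = D[OF assms(1)] D[OF assms(2)] D[OF assms(3)]
  show "((\<lambda>s. separable f g k (x + s *\<^sub>R axis \<mu> 1)) has_vector_derivative
     (if \<mu> = 1 then deriv f (x $ 1) * g (x $ 2) * k (x $ 3)
      else if \<mu> = 2 then f (x $ 1) * deriv g (x $ 2) * k (x $ 3)
      else if \<mu> = 3 then f (x $ 1) * g (x $ 2) * deriv k (x $ 3) else 0)) (at 0)"
    using exhaust_4[of \<mu>]
    unfolding separable_def line_nth has_real_derivative_iff_has_vector_derivative[symmetric]
    by (elim disjE) (auto intro!: derivative_eq_intros)
qed

lemma matrix_inv_diagonal: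
  fixes d :: "'n::finite \<Rightarrow> real"
  assumes "\<And>i. d i \<noteq> 0"
  shows "matrix_inv (\<chi> i j. if i = j then d i else 0) = (\<chi> i j. if i = j then inverse (d i) else 0)"
proof -
  let ?D = "(\<chi> i j. if i = j then d i else 0) :: real^'n^'n"
  let ?E = "(\<chi> i j. if i = j then inverse (d i) else 0) :: real^'n^'n"
  have DE: "?D ** ?E = mat 1" "?E ** ?D = mat 1"
  proof -
    have "(if i = k then d i else 0) * (if k = j then inverse (d k) else 0)
        = (if i = k then (if i = j then 1 else 0) else 0)"
      "(if i = k then inverse (d i) else 0) * (if k = j then d k else 0)
        = (if i = k then (if i = j then 1 else 0) else 0)" for i j k
      using assms by auto
    then show "?D ** ?E = mat 1" "?E ** ?D = mat 1"
      by (simp_all add: vec_eq_iff matrix_matrix_mult_def mat_def)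
  qed
  then have "?D ** matrix_inv ?D = mat 1"
    unfolding matrix_inv_def by (rule someI[of "\<lambda>M. ?D ** M = mat 1 \<and> M ** ?D = mat 1", THEN conjunct1, OF conjI])
  then have "?E ** (?D ** matrix_inv ?D) = ?E" by simp
  then show ?thesis by (simp add: matrix_mul_assoc DE)
qed

text \<open>For a diagonal metric the sum over \<open>\<sigma>\<close> collapses to \<open>\<sigma> = \<rho>\<close>, and only symbols with two equal
  indices survive.\<close>

lemma christoffel_diagonal:
  fixes d :: "real^'n::finite \<Rightarrow> 'n \<Rightarrow> real"
  assumes "\<And>i. d x i \<noteq> 0"
  shows "christoffel (\<lambda>y. \<chi> i j. if i = j then d y i else 0) \<rho> \<mu> \<nu> x =
    ((if \<nu> = \<rho> then pdiff \<mu> (\<lambda>y. d y \<rho>) x else 0) + (if \<mu> = \<rho> then pdiff \<nu> (\<lambda>y. d y \<rho>) x else 0)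
       - (if \<mu> = \<nu> then pdiff \<rho> (\<lambda>y. d y \<mu>) x else 0)) / (2 * d x \<rho>)"
proof -
  have pdiff_if: "pdiff i (\<lambda>y. if b then F y else 0) x = (if b then pdiff i F x else 0)"
    for i b and F :: "real^'n \<Rightarrow> real"
    by simp
  have "christoffel (\<lambda>y. \<chi> i j. if i = j then d y i else 0) \<rho> \<mu> \<nu> x =
     1/2 * (\<Sum>\<sigma>\<in>UNIV. if \<rho> = \<sigma> then inverse (d x \<rho>) *
    ((if \<nu> = \<sigma> then pdiff \<mu> (\<lambda>y. d y \<nu>) x else 0) + (if \<mu> = \<sigma> then pdiff \<nu> (\<lambda>y. d y \<mu>) x else 0)
       - (if \<mu> = \<nu> then pdiff \<sigma> (\<lambda>y. d y \<mu>) x else 0)) else 0)"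
    unfolding christoffel_def matrix_inv_diagonal[OF assms]
    by (intro arg_cong[where f="\<lambda>c. 1/2 * c"] sum.cong refl) (simp add: pdiff_if)
  then show ?thesis by (auto simp: field_simps)
qed

lemma scalar_curvature_diagonal:
  fixes d :: "'n::finite \<Rightarrow> real^'n \<Rightarrow> real"
  assumes "\<And>i. d i x \<noteq> 0"
  shows "scalar_curvature (\<lambda>y. \<chi> i j. if i = j then d i y else 0) x =
    (\<Sum>i\<in>UNIV. ricci (\<lambda>y. \<chi> i j. if i = j then d i y else 0) i i x / d i x)"
  unfolding scalar_curvature_def matrix_inv_diagonal[of "\<lambda>i. d i x", OF assms]
proof (rule sum.cong[OF refl])
  fix i
  have "(if i = j then inverse (d i x) else 0) * R = (if i = j then R / d i x else 0)" for j R
    by (simp add: divide_inverse)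
  then show "(\<Sum>j\<in>UNIV. (\<chi> i j. if i = j then inverse (d i x) else 0) $ i $ j
      * ricci (\<lambda>y. \<chi> i j. if i = j then d i y else 0) i j x)
    = ricci (\<lambda>y. \<chi> i j. if i = j then d i y else 0) i i x / d i x"
    by simp
qed

section \<open>Warped products of a line with the round three-sphere\<close>

text \<open>The diagonal entries of \<open>A(t) dt\<^sup>2 + B(t) \<Omega>\<^sub>3\<close>. The same shape describes the Ricci tensor of such a
  metric and the symbols \<open>\<Gamma>\<^sup>t\<^sub>\<mu>\<^sub>\<mu>\<close>.\<close>

definition warped_component :: "(real \<Rightarrow> real) \<Rightarrow> (real \<Rightarrow> real) \<Rightarrow> 4 \<Rightarrow> real^4 \<Rightarrow> real" where
  "warped_component A B i = separable (if i = 1 then A else B)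
     (if i = 3 \<or> i = 4 then (\<lambda>u. (sin u)\<^sup>2) else (\<lambda>_. 1))
     (if i = 4 then (\<lambda>u. (sin u)\<^sup>2) else (\<lambda>_. 1))"

lemma warped_component_cong:
  "A (x $ 1) = A' (x $ 1) \<Longrightarrow> B (x $ 1) = B' (x $ 1) \<Longrightarrow> warped_component A B i x = warped_component A' B' i x"
  by (simp add: warped_component_def separable_def)

definition warped_sphere_metric :: "(real \<Rightarrow> real) \<Rightarrow> (real \<Rightarrow> real) \<Rightarrow> real^4 \<Rightarrow> real^4^4" where
  "warped_sphere_metric A B = (\<lambda>y. \<chi> i j. if i = j then warped_component A B i y else 0)"

text \<open>Here \<open>p = \<Gamma>\<^sup>t\<^sub>t\<^sub>t\<close>, \<open>H = \<Gamma>\<^sup>i\<^sub>t\<^sub>i\<close> for each angle \<open>i\<close>, and \<open>P = \<Gamma>\<^sup>t\<^sub>\<psi>\<^sub>\<psi>\<close>; the remaining cases are the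
  Christoffel symbols of the round sphere, which the warping does not affect.\<close>

definition warped_christoffel ::
  "(real \<Rightarrow> real) \<Rightarrow> (real \<Rightarrow> real) \<Rightarrow> (real \<Rightarrow> real) \<Rightarrow> 4 \<Rightarrow> 4 \<Rightarrow> 4 \<Rightarrow> real^4 \<Rightarrow> real" where
  "warped_christoffel p H P \<rho> \<mu> \<nu> =
    (if \<rho> = 1 \<and> \<mu> = \<nu> then warped_component p P \<mu>
     else if \<rho> \<noteq> 1 \<and> (\<mu> = 1 \<and> \<nu> = \<rho> \<or> \<mu> = \<rho> \<and> \<nu> = 1) then separable H (\<lambda>_. 1) (\<lambda>_. 1)
     else if \<rho> = 2 \<and> \<mu> = \<nu> \<and> (\<mu> = 3 \<or> \<mu> = 4) then
       separable (\<lambda>_. -1) (\<lambda>u. sin u * cos u) (if \<mu> = 4 then (\<lambda>u. (sin u)\<^sup>2) else (\<lambda>_. 1))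
     else if (\<rho> = 3 \<or> \<rho> = 4) \<and> (\<mu> = 2 \<and> \<nu> = \<rho> \<or> \<mu> = \<rho> \<and> \<nu> = 2) then
       separable (\<lambda>_. 1) cot (\<lambda>_. 1)
     else if \<rho> = 3 \<and> \<mu> = 4 \<and> \<nu> = 4 then separable (\<lambda>_. -1) (\<lambda>_. 1) (\<lambda>u. sin u * cos u)
     else if \<rho> = 4 \<and> (\<mu> = 3 \<and> \<nu> = 4 \<or> \<mu> = 4 \<and> \<nu> = 3) then separable (\<lambda>_. 1) (\<lambda>_. 1) cot
     else (\<lambda>_. 0))"

lemma angular_differentiable:
  "(\<lambda>u::real. (sin u)\<^sup>2) field_differentiable at u"
  "(\<lambda>u::real. sin u * cos u) field_differentiable at u"
  "sin u \<noteq> 0 \<Longrightarrow> cot field_differentiable at (u::real)"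
  by (auto intro!: derivative_eq_intros DERIV_cot simp: field_differentiable_def)

lemma angular_deriv:
  "deriv (\<lambda>u::real. (sin u)\<^sup>2) u = 2 * sin u * cos u"
  "deriv (\<lambda>u::real. sin u * cos u) u = (cos u)\<^sup>2 - (sin u)\<^sup>2"
  "sin u \<noteq> 0 \<Longrightarrow> deriv cot (u::real) = - inverse ((sin u)\<^sup>2)"
  by (auto intro!: DERIV_imp_deriv derivative_eq_intros simp: power2_eq_square)
     (metis DERIV_cot power2_eq_square inverse_mult_distrib)

text \<open>The derivative hypotheses say \<open>p = A'/(2A)\<close> and \<open>H = B'/(2B)\<close>. In terms of these
  quotients the derivatives of the metric components are multiples of the components themselves, which
  cancel against the inverse metric.\<close>

lemma christoffel_warped_sphere:
  assumes A: "\<And>t. (A has_real_derivative 2 * p t * A t) (at t)" "\<And>t. A t \<noteq> 0"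
    and B: "\<And>t. (B has_real_derivative 2 * H t * B t) (at t)" "\<And>t. B t \<noteq> 0"
    and P: "\<And>t. P t * A t = - (H t * B t)"
    and x: "sin (x $ 2) \<noteq> 0" "sin (x $ 3) \<noteq> 0"
  shows "christoffel (warped_sphere_metric A B) \<rho> \<mu> \<nu> x = warped_christoffel p H P \<rho> \<mu> \<nu> x"
proof -
  have d: "A field_differentiable at t" "B field_differentiable at t"
    "deriv A t = 2 * p t * A t" "deriv B t = 2 * H t * B t" for t
    using A(1)[of t] B(1)[of t] by (auto simp: field_differentiable_def DERIV_imp_deriv)
  have nz: "warped_component A B i x \<noteq> 0" for i
    using A(2) B(2) x by (simp add: warped_component_def separable_def)
  have P': "P t = - (H t * B t) / A t" for t using P[of t] A(2)[of t] by (simp add: field_simps)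
  have "\<forall>\<rho> \<mu> \<nu>. christoffel (warped_sphere_metric A B) \<rho> \<mu> \<nu> x = warped_christoffel p H P \<rho> \<mu> \<nu> x"
    unfolding warped_sphere_metric_def christoffel_diagonal[where d="\<lambda>y i. warped_component A B i y", OF nz]
    by (simp add: forall_4,
        simp add: warped_component_def warped_christoffel_def pdiff_separable d angular_differentiable angular_deriv)
       (use A(2) B(2) x in \<open>simp add: separable_def P' cot_def power2_eq_square field_simps\<close>)
  then show ?thesis by blast
qed

text \<open>The constant 2 is the Ricci curvature of the unit three-sphere; the terms with \<open>p\<close>, \<open>H\<close> and
  \<open>P\<close> come from the warping.\<close>

lemma ricci_warped_sphere:
  assumes A: "\<And>t. (A has_real_derivative 2 * p t * A t) (at t)" "\<And>t. A t \<noteq> 0"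
    and B: "\<And>t. (B has_real_derivative 2 * H t * B t) (at t)" "\<And>t. B t \<noteq> 0"
    and P: "\<And>t. P t * A t = - (H t * B t)"
    and p': "(p has_real_derivative p') (at (x $ 1))"
    and H': "(H has_real_derivative H') (at (x $ 1))"
    and P': "(P has_real_derivative P') (at (x $ 1))"
    and x: "sin (x $ 2) \<noteq> 0" "sin (x $ 3) \<noteq> 0"
  shows "ricci (warped_sphere_metric A B) \<mu> \<nu> x =
    (if \<mu> = \<nu> then
       warped_component (\<lambda>t. 3 * (p t * H t - (H t)\<^sup>2 - H')) (\<lambda>t. P' + (p t + H t) * P t + 2) \<mu> x
     else 0)"
proof -
  have U: "open {y :: real^4. sin (y $ 2) \<noteq> 0 \<and> sin (y $ 3) \<noteq> 0}"
    by (intro open_Collect_conj open_Collect_neq continuous_intros)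
  have pd: "pdiff \<kappa> (christoffel (warped_sphere_metric A B) \<rho> \<mu> \<nu>) x
      = pdiff \<kappa> (warped_christoffel p H P \<rho> \<mu> \<nu>) x" for \<kappa> \<rho> \<mu> \<nu>
    by (rule pdiff_cong[OF U]) (use x in \<open>auto simp: christoffel_warped_sphere[OF A B P]\<close>)
  have d: "p field_differentiable at (x $ 1)" "H field_differentiable at (x $ 1)"
     "P field_differentiable at (x $ 1)"
     "deriv p (x $ 1) = p'" "deriv H (x $ 1) = H'" "deriv P (x $ 1) = P'"
    using p' H' P' by (auto simp: field_differentiable_def DERIV_imp_deriv)
  \<comment> \<open>The mixed products of sines and cosines cancel; what remains is even in each cosine, so
    eliminating the cosines leaves identities between rational functions of the sines.\<close>
  have trig: "(cos u)\<^sup>2 = 1 - (sin u)\<^sup>2" "cos u * cos u = 1 - (sin u)\<^sup>2"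
    "sin u * sin u = (sin u)\<^sup>2"
    "sin u \<noteq> 0 \<Longrightarrow> (1 - (sin u)\<^sup>2) / (sin u)\<^sup>2 = inverse ((sin u)\<^sup>2) - 1" for u :: real
    by (simp_all add: cos_squared_eq flip: power2_eq_square)
       (simp add: field_simps)
  have "\<forall>\<mu> \<nu>. ricci (warped_sphere_metric A B) \<mu> \<nu> x = (if \<mu> = \<nu> then
       warped_component (\<lambda>t. 3 * (p t * H t - (H t)\<^sup>2 - H')) (\<lambda>t. P' + (p t + H t) * P t + 2) \<mu> x
     else 0)"
    unfolding ricci_def pd christoffel_warped_sphere[OF A B P x] sum_4
    by (simp add: forall_4,
        simp add: warped_component_def warped_christoffel_def pdiff_separable d angular_differentiable angular_deriv x,
        simp add: separable_def cot_def, simp add: x trig, simp add: algebra_simps power2_eq_square)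
       (simp add: x field_simps)
  then show ?thesis by blast
qed

lemma scalar_curvature_warped_sphere:
  assumes "\<And>t. A t \<noteq> 0" "\<And>t. B t \<noteq> 0" "sin (x $ 2) \<noteq> 0" "sin (x $ 3) \<noteq> 0"
  shows "scalar_curvature (warped_sphere_metric A B) x =
    (\<Sum>i\<in>UNIV. ricci (warped_sphere_metric A B) i i x / warped_component A B i x)"
  unfolding warped_sphere_metric_def
  by (rule scalar_curvature_diagonal) (use assms in \<open>simp add: warped_component_def separable_def\<close>)

section \<open>The metric in hyperspherical coordinates\<close>

lemma has_vector_derivative_vector_4:
  assumes "(a has_real_derivative a') (at t)" "(b has_real_derivative b') (at t)"
    "(c has_real_derivative c') (at t)" "(d has_real_derivative d') (at t)"
  shows "((\<lambda>s. vector [a s, b s, c s, d s] :: real^4) has_vector_derivative vector [a', b', c', d']) (at t)"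
proof -
  have v: "(vector [a, b, c, d] :: real^4) = a *\<^sub>R axis 1 1 + b *\<^sub>R axis 2 1 + c *\<^sub>R axis 3 1 + d *\<^sub>R axis 4 1"
    for a b c d by (simp add: vec_eq_iff forall_4 vector_4 axis_def)
  have sc: "((\<lambda>s. f s *\<^sub>R w) has_vector_derivative f' *\<^sub>R w) (at t)"
    if "(f has_real_derivative f') (at t)" for f f' and w :: "real^4"
    using has_vector_derivative_scaleR[OF that has_vector_derivative_const[of w]] by simp
  show ?thesis unfolding v
    by (intro has_vector_derivative_add sc assms)
qed

text \<open>All four partial derivatives come from one calculation, along the line with direction
  \<open>e = axis \<mu> 1\<close>, by specialising the components of \<open>e\<close> at the end.\<close>

lemma pdiff_chart:
  "pdiff \<mu> chart x =
    (if \<mu> = 1 then 1 else 0,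
     if \<mu> = 2 then vector [- sin (x $ 2), cos (x $ 2) * cos (x $ 3),
        cos (x $ 2) * sin (x $ 3) * cos (x $ 4), cos (x $ 2) * sin (x $ 3) * sin (x $ 4)]
     else if \<mu> = 3 then vector [0, - (sin (x $ 2) * sin (x $ 3)),
        sin (x $ 2) * cos (x $ 3) * cos (x $ 4), sin (x $ 2) * cos (x $ 3) * sin (x $ 4)]
     else if \<mu> = 4 then vector [0, 0,
        - (sin (x $ 2) * sin (x $ 3) * sin (x $ 4)), sin (x $ 2) * sin (x $ 3) * cos (x $ 4)]
     else vector [0, 0, 0, 0])"
proof -
  define e where "e = (axis \<mu> 1 :: real^4)"
  have shift: "((\<lambda>s. x $ i + s * e $ i) has_real_derivative e $ i) (at 0)" for i
    by (auto intro!: derivative_eq_intros)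
  note [derivative_intros] = DERIV_chain2[where g = "\<lambda>s. x $ _ + s * e $ _", OF DERIV_sin shift]
    DERIV_chain2[where g = "\<lambda>s. x $ _ + s * e $ _", OF DERIV_cos shift]
  have "pdiff \<mu> chart x = (e $ 1, vector
    [- (sin (x $ 2) * e $ 2),
     cos (x $ 2) * e $ 2 * cos (x $ 3) - sin (x $ 2) * (sin (x $ 3) * e $ 3),
     (cos (x $ 2) * e $ 2 * sin (x $ 3) + sin (x $ 2) * (cos (x $ 3) * e $ 3)) * cos (x $ 4)
       - sin (x $ 2) * sin (x $ 3) * (sin (x $ 4) * e $ 4),
     (cos (x $ 2) * e $ 2 * sin (x $ 3) + sin (x $ 2) * (cos (x $ 3) * e $ 3)) * sin (x $ 4)
       + sin (x $ 2) * sin (x $ 3) * (cos (x $ 4) * e $ 4)])"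
    unfolding chart_def e_def[symmetric]
  proof (rule pdiff_eqI, unfold e_def[symmetric] vector_add_component vector_scaleR_component real_scaleR_def,
      rule has_vector_derivative_Pair)
    show "((\<lambda>s. x $ 1 + s * e $ 1) has_vector_derivative e $ 1) (at 0)"
      using shift by (simp add: has_real_derivative_iff_has_vector_derivative)
  next
    show "((\<lambda>s. vector [cos (x $ 2 + s * e $ 2), sin (x $ 2 + s * e $ 2) * cos (x $ 3 + s * e $ 3),
        sin (x $ 2 + s * e $ 2) * sin (x $ 3 + s * e $ 3) * cos (x $ 4 + s * e $ 4),
        sin (x $ 2 + s * e $ 2) * sin (x $ 3 + s * e $ 3) * sin (x $ 4 + s * e $ 4)] :: real^4)
      has_vector_derivative vector
    [- (sin (x $ 2) * e $ 2),
     cos (x $ 2) * e $ 2 * cos (x $ 3) - sin (x $ 2) * (sin (x $ 3) * e $ 3),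
     (cos (x $ 2) * e $ 2 * sin (x $ 3) + sin (x $ 2) * (cos (x $ 3) * e $ 3)) * cos (x $ 4)
       - sin (x $ 2) * sin (x $ 3) * (sin (x $ 4) * e $ 4),
     (cos (x $ 2) * e $ 2 * sin (x $ 3) + sin (x $ 2) * (cos (x $ 3) * e $ 3)) * sin (x $ 4)
       + sin (x $ 2) * sin (x $ 3) * (cos (x $ 4) * e $ 4)]) (at 0)"
      by (rule has_vector_derivative_vector_4; (rule derivative_eq_intros refl)+; simp)
  qed
  then show ?thesis
    using exhaust_4[of \<mu>] by (auto simp: e_def axis_def)
qed

text \<open>The coordinate vector fields of the chart are orthogonal, with squared lengths \<open>1\<close>,
  \<open>sin\<^sup>2\<psi>\<close>, \<open>sin\<^sup>2\<psi> sin\<^sup>2\<theta>\<close> on the sphere. Since the chart is defined on all of \<open>\<real>\<^sup>4\<close>, so is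
  this identity, coordinate singularities included.\<close>

lemma g_coord_warped:
  "g_coord \<alpha> = warped_sphere_metric (\<lambda>t. (deriv \<alpha> t)\<^sup>2 - (\<alpha> t)\<^sup>2) (\<lambda>t. (\<alpha> t)\<^sup>2 * (cosh t)\<^sup>2)"
proof
  fix x
  \<comment> \<open>The inner products of these vector fields, with \<open>s\<^sub>i\<close> and \<open>c\<^sub>i\<close> for the sine and cosine of
    the \<open>i\<close>-th coordinate.\<close>
  have gram:
    "c2 * c3 * (c2 * c3) + s2 * s2 + c2 * s3 * c4 * (c2 * s3 * c4) + c2 * s3 * s4 * (c2 * s3 * s4) = 1"
    "c2 * s3 * c4 * (s2 * c3 * c4) - c2 * c3 * (s2 * s3) + c2 * s3 * s4 * (s2 * c3 * s4) = 0"
    "s2 * c3 * c4 * (c2 * s3 * c4) - s2 * s3 * (c2 * c3) + s2 * c3 * s4 * (c2 * s3 * s4) = 0"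
    "s2 * c3 * c4 * (s2 * c3 * c4) + s2 * s3 * (s2 * s3) + s2 * c3 * s4 * (s2 * c3 * s4) = s2\<^sup>2"
    "s2 * s3 * c4 * (s2 * s3 * c4) + s2 * s3 * s4 * (s2 * s3 * s4) = s2\<^sup>2 * s3\<^sup>2"
    if "s2\<^sup>2 + c2\<^sup>2 = 1" "s3\<^sup>2 + c3\<^sup>2 = 1" "s4\<^sup>2 + c4\<^sup>2 = 1" for s2 c2 s3 c3 s4 c4 :: real
  proof -
    note expand = power2_eq_square algebra_simps
    have "c2 * c3 * (c2 * c3) + s2 * s2 + c2 * s3 * c4 * (c2 * s3 * c4) + c2 * s3 * s4 * (c2 * s3 * s4)
        = s2\<^sup>2 + c2\<^sup>2 * (s3\<^sup>2 * (s4\<^sup>2 + c4\<^sup>2) + c3\<^sup>2)"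
      by (simp add: expand)
    then show "c2 * c3 * (c2 * c3) + s2 * s2 + c2 * s3 * c4 * (c2 * s3 * c4)
        + c2 * s3 * s4 * (c2 * s3 * s4) = 1"
      using that by simp
    have "c2 * s3 * c4 * (s2 * c3 * c4) - c2 * c3 * (s2 * s3) + c2 * s3 * s4 * (s2 * c3 * s4)
        = c2 * s2 * c3 * s3 * (s4\<^sup>2 + c4\<^sup>2 - 1)"
      by (simp add: expand)
    then show "c2 * s3 * c4 * (s2 * c3 * c4) - c2 * c3 * (s2 * s3) + c2 * s3 * s4 * (s2 * c3 * s4) = 0"
      using that by simp
    then show "s2 * c3 * c4 * (c2 * s3 * c4) - s2 * s3 * (c2 * c3) + s2 * c3 * s4 * (c2 * s3 * s4) = 0"
      by (simp add: mult_ac)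
    have "s2 * c3 * c4 * (s2 * c3 * c4) + s2 * s3 * (s2 * s3) + s2 * c3 * s4 * (s2 * c3 * s4)
        = s2\<^sup>2 * (s3\<^sup>2 + c3\<^sup>2 * (s4\<^sup>2 + c4\<^sup>2))"
      by (simp add: expand)
    then show "s2 * c3 * c4 * (s2 * c3 * c4) + s2 * s3 * (s2 * s3) + s2 * c3 * s4 * (s2 * c3 * s4) = s2\<^sup>2"
      using that by simp
    have "s2 * s3 * c4 * (s2 * s3 * c4) + s2 * s3 * s4 * (s2 * s3 * s4)
        = s2\<^sup>2 * s3\<^sup>2 * (s4\<^sup>2 + c4\<^sup>2)"
      by (simp add: expand)
    then show "s2 * s3 * c4 * (s2 * s3 * c4) + s2 * s3 * s4 * (s2 * s3 * s4) = s2\<^sup>2 * s3\<^sup>2"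
      using that by simp
  qed
  note gram = gram[OF sin_cos_squared_add[of "x $ 2"] sin_cos_squared_add[of "x $ 3"]
      sin_cos_squared_add[of "x $ 4"]]
  have time: "fst (chart x) = x $ 1" by (simp add: chart_def)
  show "g_coord \<alpha> x = warped_sphere_metric (\<lambda>t. (deriv \<alpha> t)\<^sup>2 - (\<alpha> t)\<^sup>2) (\<lambda>t. (\<alpha> t)\<^sup>2 * (cosh t)\<^sup>2) x"
    unfolding g_coord_def warped_sphere_metric_def vec_eq_iff
    by (simp add: forall_4 pdiff_chart g_metric_def warped_component_def separable_def inner_vec_def sum_4 vector_4)
       (simp only: time gram mult_1_right simp_thms)
qed

section \<open>Curvature for an exponential warping\<close>

lemma cosh_sq_times_one_minus_tanh_sq: "(cosh t)\<^sup>2 * (1 - (tanh t)\<^sup>2) = (1::real)"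
proof -
  have "sinh t = tanh t * cosh t" by (simp add: tanh_def)
  then show ?thesis using cosh_square_eq[of t] by algebra
qed

text \<open>The left-hand side is \<open>P' + (p + H) P + 2\<close> for \<open>p = \<lambda>\<close>, \<open>H = \<lambda> + tanh t\<close> and
  \<open>P = H cosh\<^sup>2t / (1 - \<lambda>\<^sup>2)\<close>.\<close>

lemma f_lam_tanh:
  assumes "lam\<^sup>2 \<noteq> 1"
  shows "(1 + lam * tanh t + 2 * (lam + tanh t)\<^sup>2) * (cosh t)\<^sup>2 / (1 - lam\<^sup>2) + 2 = f_lam lam t"
proof -
  have s: "sinh t = tanh t * cosh t" by (simp add: tanh_def)
  have "(1 + lam * tanh t + 2 * (lam + tanh t)\<^sup>2) * (cosh t)\<^sup>2 + 2 * (1 - lam\<^sup>2) =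
     (lam * cosh t + sinh t) * (3 * sinh t + 2 * lam * cosh t) + 3 - 2 * lam\<^sup>2"
    unfolding s using cosh_sq_times_one_minus_tanh_sq[of t] by algebra
  moreover have "1 - lam\<^sup>2 \<noteq> 0" using assms by simp
  ultimately show ?thesis unfolding f_lam_def by (simp add: field_simps)
qed

lemma ricci_exp:
  fixes r lam :: real
  defines "\<alpha> \<equiv> \<lambda>t. r * exp (lam * t)"
  assumes "r > 0" "lam\<^sup>2 \<noteq> 1" and x: "sin (x $ 2) \<noteq> 0" "sin (x $ 3) \<noteq> 0"
  shows "ricci (g_coord \<alpha>) \<mu> \<nu> x =
    (if \<mu> = \<nu> then warped_component (\<lambda>t. - 3 * (1 + lam * tanh t)) (f_lam lam) \<mu> x else 0)"
proof -
  let ?H = "\<lambda>t. lam + tanh t" and ?P = "\<lambda>t. (lam + tanh t) * (cosh t)\<^sup>2 / (1 - lam\<^sup>2)"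
  let ?t = "x $ 1"
  have l: "1 - lam\<^sup>2 \<noteq> 0" using assms by simp
  \<comment> \<open>The function \<open>\<alpha> cosh\<close> has logarithmic derivative \<open>\<lambda> + tanh\<close>; writing \<open>sinh\<close> through \<open>tanh\<close>
    lets the simplifier see this.\<close>
  have s: "sinh t = tanh t * cosh t" for t :: real by (simp add: tanh_def)
  have "deriv \<alpha> t = lam * \<alpha> t" for t
    unfolding \<alpha>_def by (rule DERIV_imp_deriv) (auto intro!: derivative_eq_intros)
  then have g: "g_coord \<alpha> = warped_sphere_metric (\<lambda>t. (lam * \<alpha> t)\<^sup>2 - (\<alpha> t)\<^sup>2) (\<lambda>t. (\<alpha> t)\<^sup>2 * (cosh t)\<^sup>2)"
    by (simp add: g_coord_warped)
  have pos: "\<alpha> t > 0" for t using assms by (simp add: \<alpha>_def)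
  have A: "((\<lambda>t. (lam * \<alpha> t)\<^sup>2 - (\<alpha> t)\<^sup>2) has_real_derivative 2 * lam * ((lam * \<alpha> t)\<^sup>2 - (\<alpha> t)\<^sup>2)) (at t)" for t
    unfolding \<alpha>_def by (auto intro!: derivative_eq_intros simp: algebra_simps power2_eq_square)
  have B: "((\<lambda>t. (\<alpha> t)\<^sup>2 * (cosh t)\<^sup>2) has_real_derivative 2 * ?H t * ((\<alpha> t)\<^sup>2 * (cosh t)\<^sup>2)) (at t)" for t
    unfolding \<alpha>_def by (auto intro!: derivative_eq_intros simp: s algebra_simps power2_eq_square)
  have nz: "(lam * \<alpha> t)\<^sup>2 - (\<alpha> t)\<^sup>2 \<noteq> 0" "(\<alpha> t)\<^sup>2 * (cosh t)\<^sup>2 \<noteq> 0" for t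
    using pos[of t] assms by (auto simp: power_mult_distrib)
  have P: "?P t * ((lam * \<alpha> t)\<^sup>2 - (\<alpha> t)\<^sup>2) = - (?H t * ((\<alpha> t)\<^sup>2 * (cosh t)\<^sup>2))" for t
    using l by (simp add: field_simps)
  have P': "(?P has_real_derivative
      ((1 - (tanh ?t)\<^sup>2) * (cosh ?t)\<^sup>2 + ?H ?t * (2 * tanh ?t * (cosh ?t)\<^sup>2)) / (1 - lam\<^sup>2)) (at ?t)"
    by (rule DERIV_cdivide) (auto intro!: derivative_eq_intros simp: s power2_eq_square algebra_simps)
  have H': "(?H has_real_derivative 1 - (tanh ?t)\<^sup>2) (at ?t)"
    by (auto intro!: derivative_eq_intros)
  have time: "3 * (lam * ?H ?t - (?H ?t)\<^sup>2 - (1 - (tanh ?t)\<^sup>2)) = - 3 * (1 + lam * tanh ?t)"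
    by (simp add: power2_eq_square algebra_simps)
  have angular: "((1 - (tanh ?t)\<^sup>2) * (cosh ?t)\<^sup>2 + ?H ?t * (2 * tanh ?t * (cosh ?t)\<^sup>2)) / (1 - lam\<^sup>2)
      + (lam + ?H ?t) * ?P ?t + 2 = f_lam lam ?t"
  proof -
    have split: "X / k + a * (b / k) = (X + a * b) / k" for X k a b :: real
      by (simp add: add_divide_distrib)
    have "(1 - (tanh ?t)\<^sup>2) * (cosh ?t)\<^sup>2 + ?H ?t * (2 * tanh ?t * (cosh ?t)\<^sup>2)
        + (lam + ?H ?t) * (?H ?t * (cosh ?t)\<^sup>2)
      = (1 + lam * tanh ?t + 2 * (lam + tanh ?t)\<^sup>2) * (cosh ?t)\<^sup>2"
      by algebra
    then show ?thesis
      unfolding split f_lam_tanh[OF assms(3), symmetric] by (simp only:)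
  qed
  have R: "ricci (g_coord \<alpha>) \<mu> \<nu> x = (if \<mu> = \<nu> then
      warped_component (\<lambda>t. 3 * (lam * ?H t - (?H t)\<^sup>2 - (1 - (tanh ?t)\<^sup>2)))
        (\<lambda>t. ((1 - (tanh ?t)\<^sup>2) * (cosh ?t)\<^sup>2 + ?H ?t * (2 * tanh ?t * (cosh ?t)\<^sup>2)) / (1 - lam\<^sup>2)
           + (lam + ?H t) * ?P t + 2) \<mu> x else 0)"
    unfolding g
    by (rule ricci_warped_sphere[where p = "\<lambda>_. lam" and H = ?H and P = ?P, OF A nz(1) B nz(2) P DERIV_const H' P' x])
  show ?thesis
    unfolding R by (intro if_cong refl warped_component_cong time angular)
qed

lemma scalar_curvature_exp:
  fixes r lam :: real
  defines "\<alpha> \<equiv> \<lambda>t. r * exp (lam * t)"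
  assumes "r > 0" "lam\<^sup>2 \<noteq> 1" and x: "sin (x $ 2) \<noteq> 0" "sin (x $ 3) \<noteq> 0"
  shows "scalar_curvature (g_coord \<alpha>) x =
    3 / (\<alpha> (x $ 1))\<^sup>2 * ((1 + lam * tanh (x $ 1)) / (1 - lam\<^sup>2) + f_lam lam (x $ 1) / (cosh (x $ 1))\<^sup>2)"
proof -
  let ?t = "x $ 1"
  have "deriv \<alpha> t = lam * \<alpha> t" for t
    unfolding \<alpha>_def by (rule DERIV_imp_deriv) (auto intro!: derivative_eq_intros)
  then have g: "g_coord \<alpha> = warped_sphere_metric (\<lambda>t. (\<alpha> t)\<^sup>2 * (lam\<^sup>2 - 1)) (\<lambda>t. (\<alpha> t)\<^sup>2 * (cosh t)\<^sup>2)"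
    by (simp add: g_coord_warped algebra_simps)
  have a: "\<alpha> t \<noteq> 0" for t using assms by (simp add: \<alpha>_def)
  have nz: "(\<alpha> t)\<^sup>2 * (lam\<^sup>2 - 1) \<noteq> 0" "(\<alpha> t)\<^sup>2 * (cosh t)\<^sup>2 \<noteq> 0" for t
    using a[of t] assms by auto
  have "scalar_curvature (g_coord \<alpha>) x = (\<Sum>i\<in>UNIV. ricci (g_coord \<alpha>) i i x /
         warped_component (\<lambda>t. (\<alpha> t)\<^sup>2 * (lam\<^sup>2 - 1)) (\<lambda>t. (\<alpha> t)\<^sup>2 * (cosh t)\<^sup>2) i x)"
    unfolding g by (rule scalar_curvature_warped_sphere[OF nz x])
  also have "\<dots> = (\<Sum>i\<in>UNIV. warped_component (\<lambda>t. - 3 * (1 + lam * tanh t)) (f_lam lam) i x /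
         warped_component (\<lambda>t. (\<alpha> t)\<^sup>2 * (lam\<^sup>2 - 1)) (\<lambda>t. (\<alpha> t)\<^sup>2 * (cosh t)\<^sup>2) i x)"
    by (simp only: ricci_exp[OF assms(2,3) x, folded \<alpha>_def] if_True refl)
  also have "\<dots> = - 3 * (1 + lam * tanh ?t) / ((\<alpha> ?t)\<^sup>2 * (lam\<^sup>2 - 1)) + 3 * (f_lam lam ?t / ((\<alpha> ?t)\<^sup>2 * (cosh ?t)\<^sup>2))"
  proof -
    have "(\<Sum>i\<in>UNIV. warped_component T F i x / warped_component A B i x) = T ?t / A ?t + 3 * (F ?t / B ?t)" for T F A B
      using x by (simp add: sum_4 warped_component_def separable_def)
    then show ?thesis .
  qed
  also have "\<dots> = 3 / (\<alpha> ?t)\<^sup>2 * ((1 + lam * tanh ?t) / (1 - lam\<^sup>2) + f_lam lam ?t / (cosh ?t)\<^sup>2)"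
  proof -
    have "- 3 * u / (a * (lam\<^sup>2 - 1)) + 3 * (f / (a * c)) = 3 / a * (u / (1 - lam\<^sup>2) + f / c)"
      for u a f c :: real
    proof -
      have "lam\<^sup>2 - 1 = - (1 - lam\<^sup>2)" by simp
      then have "- 3 * u / (a * (lam\<^sup>2 - 1)) = 3 * u / (a * (1 - lam\<^sup>2))"
        by (simp only: mult_minus_right mult_minus_left minus_divide_divide)
      then show ?thesis
        by (simp only: distrib_left times_divide_eq_left times_divide_eq_right divide_divide_eq_left)
    qed
    then show ?thesis .
  qed
  finally show ?thesis .
qed

text \<open>Substituting \<open>1 / cosh\<^sup>2t = 1 - tanh\<^sup>2t\<close> turns the bracket into a quadratic polynomial in
  \<open>\<lambda> tanh t\<close> that factors. For \<open>\<bar>\<lambda>\<bar> < 1\<close> both factors stay between positive bounds, so the exponential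
  alone governs the behaviour at infinity.\<close>

lemma scalar_curvature_factored:
  assumes "lam\<^sup>2 \<noteq> 1"
  shows "3 / (r * exp (lam * t))\<^sup>2 * ((1 + lam * tanh t) / (1 - lam\<^sup>2) + f_lam lam t / (cosh t)\<^sup>2)
    = 6 / (r\<^sup>2 * (1 - lam\<^sup>2)) * ((1 + lam * tanh t) * (2 + lam * tanh t)) * exp (- 2 * lam * t)"
proof -
  have "f_lam lam t / (cosh t)\<^sup>2 = (1 + lam * tanh t + 2 * (lam + tanh t)\<^sup>2) / (1 - lam\<^sup>2) + 2 * (1 - (tanh t)\<^sup>2)"
  proof -
    have "1 - (tanh t)\<^sup>2 = 1 / (cosh t)\<^sup>2"
      using cosh_sq_times_one_minus_tanh_sq[of t] by (simp add: eq_divide_eq mult.commute)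
    then show ?thesis
      unfolding f_lam_tanh[OF assms, symmetric] by (simp add: add_divide_distrib)
  qed
  also have "(1 + lam * tanh t) / (1 - lam\<^sup>2) + \<dots> = 2 * ((1 + lam * tanh t) * (2 + lam * tanh t)) / (1 - lam\<^sup>2)"
  proof -
    have k: "1 - lam\<^sup>2 \<noteq> 0" using assms by simp
    have "a / k + (b / k + c) = (a + b + c * k) / k" if "k \<noteq> 0" for a b c k :: real
      using that by (simp add: field_simps)
    note this[OF k]
    moreover have "1 + lam * tanh t + (1 + lam * tanh t + 2 * (lam + tanh t)\<^sup>2)
        + 2 * (1 - (tanh t)\<^sup>2) * (1 - lam\<^sup>2) = 2 * ((1 + lam * tanh t) * (2 + lam * tanh t))"
      by (simp add: algebra_simps power2_eq_square)
    ultimately show ?thesis by (simp only:)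
  qed
  finally have bracket: "(1 + lam * tanh t) / (1 - lam\<^sup>2) + f_lam lam t / (cosh t)\<^sup>2 = 2 * ((1 + lam * tanh t) * (2 + lam * tanh t)) / (1 - lam\<^sup>2)" .
  have "(exp (lam * t))\<^sup>2 = exp (2 * lam * t)"
    using exp_double[of "lam * t"] by (simp only: mult.assoc)
  then have e: "exp (- 2 * lam * t) = 1 / (exp (lam * t))\<^sup>2"
    by (simp only: mult_minus_left exp_minus inverse_eq_divide)
  have "3 / (a * b) * (2 * q / k) = 6 / (a * k) * q * (1 / b)" for a b k q :: real
    by simp
  then show ?thesis unfolding bracket e power_mult_distrib .
qed

lemma exp_tanh_limits:
  fixes c lam :: real
  assumes "0 < c" "\<bar>lam\<bar> < 1"
  defines "S \<equiv> \<lambda>t. c * ((1 + lam * tanh t) * (2 + lam * tanh t)) * exp (- 2 * lam * t)"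
  shows "0 < lam \<Longrightarrow> (S \<longlongrightarrow> 0) at_top" "0 < lam \<Longrightarrow> filterlim S at_top at_bot"
    and "lam < 0 \<Longrightarrow> filterlim S at_top at_top" "lam < 0 \<Longrightarrow> (S \<longlongrightarrow> 0) at_bot"
proof -
  have top: "((\<lambda>t. c * ((1 + lam * tanh t) * (2 + lam * tanh t))) \<longlongrightarrow>
      c * ((1 + lam * 1) * (2 + lam * 1))) at_top"
    by (intro tendsto_intros tanh_real_at_top)
  have bot: "((\<lambda>t. c * ((1 + lam * tanh t) * (2 + lam * tanh t))) \<longlongrightarrow>
      c * ((1 + lam * -1) * (2 + lam * -1))) at_bot"
    by (intro tendsto_intros tanh_real_at_bot)
  have pos: "c * ((1 + lam * 1) * (2 + lam * 1)) > 0" "c * ((1 + lam * -1) * (2 + lam * -1)) > 0"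
    using assms by (auto intro!: mult_pos_pos)
  have lin: "filterlim (\<lambda>t. a * t) at_top at_top" "filterlim (\<lambda>t. a * t) at_bot at_bot"
    "filterlim (\<lambda>t. - a * t) at_bot at_top" "filterlim (\<lambda>t. - a * t) at_top at_bot" if "a > 0" for a :: real
  proof -
    show top: "filterlim (\<lambda>t. a * t) at_top at_top"
      using that by (rule filterlim_tendsto_pos_mult_at_top[OF tendsto_const _ filterlim_ident])
    show bot: "filterlim (\<lambda>t. a * t) at_bot at_bot"
      using that by (rule filterlim_tendsto_pos_mult_at_bot[OF tendsto_const _ filterlim_ident])
    show "filterlim (\<lambda>t. - a * t) at_bot at_top" "filterlim (\<lambda>t. - a * t) at_top at_bot"
      using top bot filterlim_uminus_at_top[of "\<lambda>t. a * t" at_top]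
        filterlim_uminus_at_bot[of "\<lambda>t. a * t" at_bot]
      by (simp_all only: mult_minus_left)
  qed
  show "(S \<longlongrightarrow> 0) at_top" if "0 < lam"
    using tendsto_mult[OF top filterlim_compose[OF exp_at_bot lin(3)[of "2 * lam"]]] that
    by (simp add: S_def)
  show "filterlim S at_top at_bot" if "0 < lam"
    using filterlim_tendsto_pos_mult_at_top[OF bot pos(2) filterlim_compose[OF exp_at_top lin(4)[of "2 * lam"]]] that
    by (simp add: S_def)
  show "filterlim S at_top at_top" if "lam < 0"
    using filterlim_tendsto_pos_mult_at_top[OF top pos(1) filterlim_compose[OF exp_at_top lin(1)[of "- 2 * lam"]]] that
    by (simp add: S_def)
  show "(S \<longlongrightarrow> 0) at_bot" if "lam < 0"
    using tendsto_mult[OF bot filterlim_compose[OF exp_at_bot lin(2)[of "- 2 * lam"]]] that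
    by (simp add: S_def)
qed

section \<open>The isometry\<close>

text \<open>The directional derivatives of such a map are again of this form, with a multiple of the
  constant direction entering through \<open>C\<close>; this is why the induction needs the third summand, although
  \<open>Phi\<close> itself has \<open>C = 0\<close>. The sequences list the successive derivatives of the coefficients.\<close>

lemma C_k_radial:
  fixes A B :: "nat \<Rightarrow> real \<Rightarrow> real" and C :: "nat \<Rightarrow> real \<Rightarrow> 'a::real_normed_vector"
  assumes "\<And>n t. (A n has_real_derivative A (Suc n) t) (at t)"
    and "\<And>n t. (B n has_real_derivative B (Suc n) t) (at t)"
    and "\<And>n t. (C n has_vector_derivative C (Suc n) t) (at t)"
  shows "C_k k (\<lambda>p. (A 0 (fst p), B 0 (fst p) *\<^sub>R snd p + C 0 (fst p)))"
  using assms
proof (induction k arbitrary: A B C)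
  case (Suc k)
  note [derivative_intros] =
    has_derivative_compose[OF has_derivative_fst Suc.prems(1)[unfolded has_field_derivative_def]]
    has_derivative_compose[OF has_derivative_fst Suc.prems(2)[unfolded has_field_derivative_def]]
    has_derivative_compose[OF has_derivative_fst Suc.prems(3)[unfolded has_vector_derivative_def]]
  have D: "((\<lambda>p. (A 0 (fst p), B 0 (fst p) *\<^sub>R snd p + C 0 (fst p))) has_derivative
      (\<lambda>v. (fst v * A 1 (fst p), (fst v * B 1 (fst p)) *\<^sub>R snd p
          + (B 0 (fst p) *\<^sub>R snd v + fst v *\<^sub>R C 1 (fst p))))) (at p)" for p :: "real \<times> 'a"
    by (auto intro!: derivative_eq_intros simp: algebra_simps)
  have "C_k k (\<lambda>p. (fst v * A (Suc 0) (fst p), (fst v * B (Suc 0) (fst p)) *\<^sub>R snd p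
          + (B 0 (fst p) *\<^sub>R snd v + fst v *\<^sub>R C (Suc 0) (fst p))))" for v :: "real \<times> 'a"
    by (rule Suc.IH[of "\<lambda>n t. fst v * A (Suc n) t" "\<lambda>n t. fst v * B (Suc n) t"
          "\<lambda>n t. B n t *\<^sub>R snd v + fst v *\<^sub>R C (Suc n) t"])
       (auto intro!: derivative_eq_intros Suc.prems simp: algebra_simps)
  then have "C_k k (\<lambda>p. frechet_derivative (\<lambda>p. (A 0 (fst p), B 0 (fst p) *\<^sub>R snd p + C 0 (fst p))) (at p) v)" for v
    by (simp flip: frechet_derivative_at[OF D])
  then show ?case
    unfolding C_k.simps using D differentiableI by blast
next
  case 0
  have "continuous_on UNIV (A 0)" "continuous_on UNIV (B 0)" "continuous_on UNIV (C 0)"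
    using DERIV_isCont[OF 0(1)] DERIV_isCont[OF 0(2)] has_vector_derivative_continuous[OF 0(3)]
    by (auto intro!: continuous_at_imp_continuous_on)
  then have "continuous_on UNIV (\<lambda>p. A 0 (fst p))" "continuous_on UNIV (\<lambda>p. B 0 (fst p))" "continuous_on UNIV (\<lambda>p. C 0 (fst p))"
    by (auto intro!: continuous_on_compose2[of UNIV _ UNIV fst] continuous_intros)
  then show ?case by (auto intro!: continuous_intros)
qed

lemma exp_sinh_cosh:
  fixes r lam t :: real
  shows "r * exp (lam * t) * sinh t = r / 2 * (exp ((lam + 1) * t) - exp ((lam - 1) * t))"
    and "r * exp (lam * t) * cosh t = r / 2 * (exp ((lam + 1) * t) + exp ((lam - 1) * t))"
  by (simp_all add: sinh_def cosh_def algebra_simps exp_add exp_diff exp_minus field_simps)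

text \<open>In exponential form the coefficients of \<open>Phi\<close> have explicit derivatives of all orders.\<close>

lemma C_k_Phi_exp:
  fixes r lam :: real
  shows "C_k k (Phi (\<lambda>t. r * exp (lam * t)))"
proof -
  \<comment> \<open>The \<open>n\<close>-th derivative of \<open>\<alpha> sinh\<close> for \<open>c = -1\<close>, of \<open>\<alpha> cosh\<close> for \<open>c = 1\<close>.\<close>
  define E where "E c n t = r / 2 * ((lam + 1)^n * exp ((lam + 1) * t) + c * (lam - 1)^n * exp ((lam - 1) * t))"
    for c t and n :: nat
  have E: "(E c n has_real_derivative E c (Suc n) t) (at t)" for c n t
    unfolding E_def by (auto intro!: derivative_eq_intros simp: field_simps)
  have "C_k k (\<lambda>p. (E (-1) 0 (fst p), E 1 0 (fst p) *\<^sub>R snd p + 0))"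
    by (rule C_k_radial[where C = "\<lambda>_ _. 0"]) (auto intro: E)
  also have "(\<lambda>p. (E (-1) 0 (fst p), E 1 0 (fst p) *\<^sub>R snd p + 0)) = Phi (\<lambda>t. r * exp (lam * t))"
    by (auto simp: Phi_def E_def exp_sinh_cosh fun_eq_iff)
  finally show ?thesis .
qed

text \<open>A tangent vector of the sphere is orthogonal to \<open>z\<close>, so the mixed terms between the radial and
  the spherical directions vanish.\<close>

lemma pullback_eta_Phi:
  assumes "(\<alpha> has_real_derivative \<alpha>') (at (fst p))"
    and "p \<in> RS3" "u \<in> tangent_RS3 p" "v \<in> tangent_RS3 p"
  shows "eta (frechet_derivative (Phi \<alpha>) (at p) u) (frechet_derivative (Phi \<alpha>) (at p) v) = g_metric \<alpha> p u v"
proof -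
  have time: "((\<lambda>q. f (fst q)) has_derivative (\<lambda>w. f' * fst w)) (at p)"
    if "(f has_real_derivative f') (at (fst p))" for f f'
    using that unfolding has_field_derivative_def
    by (rule has_derivative_compose[OF has_derivative_fst[OF has_derivative_ident]])
  have [derivative_intros]: "((\<lambda>q. \<alpha> (fst q)) has_derivative (\<lambda>w. \<alpha>' * fst w)) (at p)"
    "((\<lambda>q. sinh (fst q)) has_derivative (\<lambda>w. cosh (fst p) * fst w)) (at p)"
    "((\<lambda>q. cosh (fst q)) has_derivative (\<lambda>w. sinh (fst p) * fst w)) (at p)"
    by (auto intro!: time assms(1) derivative_eq_intros)
  let ?t = "fst p" and ?z = "snd p"
  have "(Phi \<alpha> has_derivative
      (\<lambda>w. (fst w * (\<alpha>' * sinh ?t + \<alpha> ?t * cosh ?t),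
        (fst w * (\<alpha>' * cosh ?t + \<alpha> ?t * sinh ?t)) *\<^sub>R ?z + (\<alpha> ?t * cosh ?t) *\<^sub>R snd w))) (at p)"
    unfolding Phi_def case_prod_beta
    by (auto intro!: derivative_eq_intros simp: algebra_simps)
  note D = frechet_derivative_at[OF this, symmetric]
  have z: "?z \<bullet> ?z = 1" "?z \<bullet> snd u = 0" "?z \<bullet> snd v = 0" "snd u \<bullet> ?z = 0"
    using assms by (auto simp: RS3_def tangent_RS3_def dot_square_norm inner_commute)
  have c: "(cosh ?t)\<^sup>2 = (sinh ?t)\<^sup>2 + 1" by (rule cosh_square_eq)
  have d: "deriv \<alpha> ?t = \<alpha>'" using assms(1) by (rule DERIV_imp_deriv)
  have minkowski: "- ((a * (\<alpha>' * s + q * k)) * (b * (\<alpha>' * s + q * k)))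
      + ((a * (\<alpha>' * k + q * s)) * (b * (\<alpha>' * k + q * s)) + (q * k) * (q * k) * m)
      = (\<alpha>'\<^sup>2 - q\<^sup>2) * (a * b) + q\<^sup>2 * k\<^sup>2 * m" if "k\<^sup>2 = s\<^sup>2 + 1" for a b s k q m :: real
    using that by algebra
  show ?thesis
    using minkowski[OF c, of "fst u" "\<alpha> ?t" "fst v" "snd u \<bullet> snd v"]
    by (simp add: D d eta_def g_metric_def inner_add z algebra_simps)
qed

text \<open>The inverse recovers \<open>t\<close> from the time coordinate and divides the spatial part by
  \<open>\<alpha> t cosh t\<close>, which is its norm. A continuous injective function on the line has a continuous
  inverse on its range.\<close>

lemma homeomorphism_Phi:
  assumes cont: "continuous_on UNIV \<alpha>" and pos: "\<And>t. 0 < \<alpha> t"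
    and h: "inj (h_fun \<alpha>)"
  shows "\<exists>F'. homeomorphism RS3 (dS4 (range (h_fun \<alpha>)) (f_alpha \<alpha>)) (Phi \<alpha>) F'"
proof -
  let ?h = "h_fun \<alpha>"
  let ?F' = "\<lambda>x. (inv ?h (fst x), inverse (\<alpha> (inv ?h (fst x)) * cosh (inv ?h (fst x))) *\<^sub>R snd x)"
  have nz: "\<alpha> t * cosh t \<noteq> 0" for t using pos[of t] by (simp add: cosh_real_nonzero)
  have cancel: "inverse (\<alpha> t * cosh t) * (\<alpha> t * cosh t) = 1"
    "\<alpha> t * cosh t * inverse (\<alpha> t * cosh t) = 1" for t
    using nz[of t] by (simp_all del: inverse_mult_distrib)
  have inv [simp]: "inv ?h (?h t) = t" for t using h by simp
  have conth: "continuous_on UNIV ?h" unfolding h_fun_def by (intro continuous_intros cont)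
  have "isCont (inv ?h) (?h t)" for t
    by (rule isCont_inverse_function[where d = 1])
       (use conth in \<open>auto simp: continuous_on_eq_continuous_at\<close>)
  then have ci: "continuous_on (range ?h) (inv ?h)"
    by (auto intro!: continuous_at_imp_continuous_on)
  have "homeomorphism RS3 (dS4 (range ?h) (f_alpha \<alpha>)) (Phi \<alpha>) ?F'"
  proof (rule homeomorphismI)
    have "continuous_on RS3 (\<lambda>p. \<alpha> (fst p))"
      by (rule continuous_on_compose2[OF cont]) (auto intro!: continuous_intros)
    then show "continuous_on RS3 (Phi \<alpha>)"
      unfolding Phi_def case_prod_beta by (intro continuous_intros)
    have ci': "continuous_on (dS4 (range ?h) (f_alpha \<alpha>)) (\<lambda>x. inv ?h (fst x))"
      by (rule continuous_on_compose2[OF ci]) (auto intro!: continuous_intros simp: dS4_def)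
    have "continuous_on (dS4 (range ?h) (f_alpha \<alpha>)) (\<lambda>x. \<alpha> (inv ?h (fst x)))"
      by (rule continuous_on_compose2[OF cont ci']) auto
    then show "continuous_on (dS4 (range ?h) (f_alpha \<alpha>)) ?F'"
      using nz by (intro continuous_intros ci') auto
  next
    have sq: "(\<Sum>i\<in>UNIV. (z $ i)\<^sup>2) = (norm z)\<^sup>2" for z :: "real^4"
      unfolding power2_norm_eq_inner inner_vec_def by (simp add: power2_eq_square)
    have eq: "Phi \<alpha> (t, z) = (?h t, (\<alpha> t * cosh t) *\<^sub>R z)" for t z
      by (simp add: Phi_def h_fun_def)
    have mem: "(?h t, w) \<in> dS4 (range ?h) (f_alpha \<alpha>) \<longleftrightarrow> norm w = \<alpha> t * cosh t" for t w
    proof -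
      have "(?h t, w) \<in> dS4 (range ?h) (f_alpha \<alpha>) \<longleftrightarrow> - (?h t)\<^sup>2 + (norm w)\<^sup>2 = (\<alpha> t)\<^sup>2"
        by (simp add: dS4_def sq f_alpha_def)
      also have "\<dots> \<longleftrightarrow> (norm w)\<^sup>2 = (\<alpha> t * cosh t)\<^sup>2"
        by (simp add: h_fun_def power_mult_distrib cosh_square_eq algebra_simps)
      also have "\<dots> \<longleftrightarrow> norm w = \<alpha> t * cosh t"
        using pos[of t] by (simp add: cosh_real_nonneg)
      finally show ?thesis .
    qed
    show "Phi \<alpha> ` RS3 \<subseteq> dS4 (range ?h) (f_alpha \<alpha>)"
      using pos less_imp_le[OF pos] by (auto simp: RS3_def eq mem abs_mult)
    show "?F' ` dS4 (range ?h) (f_alpha \<alpha>) \<subseteq> RS3"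
    proof (intro image_subsetI)
      fix x assume x: "x \<in> dS4 (range ?h) (f_alpha \<alpha>)"
      then obtain t w where tw: "x = (?h t, w)" by (cases x) (auto simp: dS4_def)
      then have "norm w = \<alpha> t * cosh t" using x mem by simp
      then show "?F' x \<in> RS3"
        using pos[of t] by (simp add: tw RS3_def abs_mult field_simps)
    qed
    show "?F' (Phi \<alpha> p) = p" if "p \<in> RS3" for p
      by (cases p) (simp add: eq cancel del: inverse_mult_distrib)
    show "Phi \<alpha> (?F' x) = x" if "x \<in> dS4 (range ?h) (f_alpha \<alpha>)" for x
      using that by (cases x) (auto simp: eq dS4_def cancel simp del: inverse_mult_distrib)
  qed
  then show ?thesis by blast
qed

lemma inj_h_fun_exp:
  fixes r lam :: real
  assumes "r > 0" "-1 < lam" "lam < 1"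
  shows "inj (h_fun (\<lambda>t. r * exp (lam * t)))"
proof -
  have "strict_mono (h_fun (\<lambda>t. r * exp (lam * t)))"
  proof (rule strict_monoI)
    fix a b :: real
    have D: "\<exists>y. (h_fun (\<lambda>t. r * exp (lam * t)) has_real_derivative y) (at t) \<and> 0 < y" for t
    proof -
    have "\<bar>lam * sinh t\<bar> < cosh t"
    proof -
      have "\<bar>lam * sinh t\<bar> \<le> \<bar>sinh t\<bar>"
        using assms by (simp add: abs_mult mult_left_le_one_le)
      also have "\<dots> < cosh t"
        using sinh_less_cosh_real[of t] sinh_less_cosh_real[of "-t"] by (auto simp: abs_if)
      finally show ?thesis .
    qed
    then have "0 < r * exp (lam * t) * (lam * sinh t + cosh t)"
      using assms by (intro mult_pos_pos) auto
    moreover have "(h_fun (\<lambda>t. r * exp (lam * t)) has_real_derivative r * exp (lam * t) * (lam * sinh t + cosh t)) (at t)"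
      unfolding h_fun_def by (auto intro!: derivative_eq_intros simp: algebra_simps)
    ultimately show ?thesis by blast
    qed
    show "h_fun (\<lambda>t. r * exp (lam * t)) a < h_fun (\<lambda>t. r * exp (lam * t)) b" if "a < b"
      using that D by (rule DERIV_pos_imp_increasing)
  qed
  then show ?thesis by (rule strict_mono_on_imp_inj_on)
qed

section \<open>The theorem\<close>

theorem mainTheorem9:
  fixes r lam :: real and \<alpha> :: "real \<Rightarrow> real"
  assumes "r > 0" and "-1 < lam" and "lam < 1"
    and "\<forall>t. \<alpha> t = r * exp (lam * t)"
  shows "isometry_RS3_onto (g_metric \<alpha>) (dS4 (range (h_fun \<alpha>)) (f_alpha \<alpha>)) (Phi \<alpha>) \<and>
    (\<forall>\<psi> \<theta> \<phi>. 0 < \<psi> \<and> \<psi> < pi \<and> 0 < \<theta> \<and> \<theta> < pi \<longrightarrow>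
      (\<forall>t. let x = vector [t, \<psi>, \<theta>, \<phi>] :: real^4 in
        ricci (g_coord \<alpha>) 1 1 x = - 3 * (1 + lam * tanh t) \<and>
        ricci (g_coord \<alpha>) 2 2 x = f_lam lam t \<and>
        ricci (g_coord \<alpha>) 3 3 x = f_lam lam t * (sin \<psi>)\<^sup>2 \<and>
        ricci (g_coord \<alpha>) 4 4 x = f_lam lam t * (sin \<psi>)\<^sup>2 * (sin \<theta>)\<^sup>2 \<and>
        (\<forall>\<mu> \<nu>. \<mu> \<noteq> \<nu> \<longrightarrow> ricci (g_coord \<alpha>) \<mu> \<nu> x = 0) \<and>
        scalar_curvature (g_coord \<alpha>) x =
          3 / (\<alpha> t)\<^sup>2 * ((1 + lam * tanh t) / (1 - lam\<^sup>2) + f_lam lam t / (cosh t)\<^sup>2)) \<and>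
      (let S = (\<lambda>t. scalar_curvature (g_coord \<alpha>) (vector [t, \<psi>, \<theta>, \<phi>])) in
        (0 < lam \<longrightarrow> (S \<longlongrightarrow> 0) at_top \<and> filterlim S at_top at_bot) \<and>
        (lam < 0 \<longrightarrow> filterlim S at_top at_top \<and> (S \<longlongrightarrow> 0) at_bot)))"
proof -
  have \<alpha>: "\<alpha> = (\<lambda>t. r * exp (lam * t))" using assms(4) by auto
  have l: "lam\<^sup>2 < 1" using assms(2,3) by (simp add: abs_square_less_1)
  have deriv: "(\<alpha> has_real_derivative r * exp (lam * t) * lam) (at t)" for t
    unfolding \<alpha> by (auto intro!: derivative_eq_intros)
  have "isometry_RS3_onto (g_metric \<alpha>) (dS4 (range (h_fun \<alpha>)) (f_alpha \<alpha>)) (Phi \<alpha>)"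
    unfolding isometry_RS3_onto_def
  proof (intro conjI allI ballI)
    show "C_k k (Phi \<alpha>)" for k
      unfolding \<alpha> by (rule C_k_Phi_exp)
    show "\<exists>F'. homeomorphism RS3 (dS4 (range (h_fun \<alpha>)) (f_alpha \<alpha>)) (Phi \<alpha>) F'"
    proof (rule homeomorphism_Phi)
      show "continuous_on UNIV \<alpha>" using deriv DERIV_isCont continuous_at_imp_continuous_on by blast
      show "0 < \<alpha> t" for t using assms(1) by (simp add: \<alpha>)
      show "inj (h_fun \<alpha>)" unfolding \<alpha> using assms(1-3) by (rule inj_h_fun_exp)
    qed
    show "eta (frechet_derivative (Phi \<alpha>) (at p) u) (frechet_derivative (Phi \<alpha>) (at p) v)
        = g_metric \<alpha> p u v" if "p \<in> RS3" "u \<in> tangent_RS3 p" "v \<in> tangent_RS3 p" for p u v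
      using deriv that by (rule pullback_eta_Phi)
  qed
  moreover have "\<forall>\<psi> \<theta> \<phi>. 0 < \<psi> \<and> \<psi> < pi \<and> 0 < \<theta> \<and> \<theta> < pi \<longrightarrow>
      (\<forall>t. let x = vector [t, \<psi>, \<theta>, \<phi>] :: real^4 in
        ricci (g_coord \<alpha>) 1 1 x = - 3 * (1 + lam * tanh t) \<and>
        ricci (g_coord \<alpha>) 2 2 x = f_lam lam t \<and>
        ricci (g_coord \<alpha>) 3 3 x = f_lam lam t * (sin \<psi>)\<^sup>2 \<and>
        ricci (g_coord \<alpha>) 4 4 x = f_lam lam t * (sin \<psi>)\<^sup>2 * (sin \<theta>)\<^sup>2 \<and>
        (\<forall>\<mu> \<nu>. \<mu> \<noteq> \<nu> \<longrightarrow> ricci (g_coord \<alpha>) \<mu> \<nu> x = 0) \<and>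
        scalar_curvature (g_coord \<alpha>) x =
          3 / (\<alpha> t)\<^sup>2 * ((1 + lam * tanh t) / (1 - lam\<^sup>2) + f_lam lam t / (cosh t)\<^sup>2)) \<and>
      (let S = (\<lambda>t. scalar_curvature (g_coord \<alpha>) (vector [t, \<psi>, \<theta>, \<phi>])) in
        (0 < lam \<longrightarrow> (S \<longlongrightarrow> 0) at_top \<and> filterlim S at_top at_bot) \<and>
        (lam < 0 \<longrightarrow> filterlim S at_top at_top \<and> (S \<longlongrightarrow> 0) at_bot))"
    (is "\<forall>\<psi> \<theta> \<phi>. _ \<longrightarrow> (\<forall>t. ?local \<psi> \<theta> \<phi> t) \<and> ?limits \<psi> \<theta> \<phi>")
  proof (intro allI impI conjI)
    fix \<psi> \<theta> \<phi> :: real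
    assume "0 < \<psi> \<and> \<psi> < pi \<and> 0 < \<theta> \<and> \<theta> < pi"
    then have sin: "sin \<psi> \<noteq> 0" "sin \<theta> \<noteq> 0"
      using sin_gt_zero by (metis less_irrefl)+
    let ?x = "\<lambda>t. vector [t, \<psi>, \<theta>, \<phi>] :: real^4"
    have x: "sin (?x t $ 2) \<noteq> 0" "sin (?x t $ 3) \<noteq> 0" for t
      using sin by (simp_all add: vector_4)
    have l1: "lam\<^sup>2 \<noteq> 1" using l by simp
    note S = scalar_curvature_exp[OF assms(1) l1 x, folded \<alpha>, unfolded vector_4]
    show "?local \<psi> \<theta> \<phi> t" for t
      unfolding Let_def S
      by (simp add: ricci_exp[OF assms(1) l1 x, folded \<alpha>] assms(4) warped_component_def separable_def vector_4)
    have "0 < 6 / (r\<^sup>2 * (1 - lam\<^sup>2))" "\<bar>lam\<bar> < 1"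
      using assms l by auto
    note lim = exp_tanh_limits[OF this]
    have S': "scalar_curvature (g_coord \<alpha>) (?x t) =
        6 / (r\<^sup>2 * (1 - lam\<^sup>2)) * ((1 + lam * tanh t) * (2 + lam * tanh t)) * exp (- 2 * lam * t)" for t
      unfolding S using scalar_curvature_factored[OF l1, of r t] by (simp only: \<alpha>)
    show "?limits \<psi> \<theta> \<phi>"
      unfolding Let_def S' using lim by blast
  qed
  ultimately show ?thesis by (rule conjI)
qed

end
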